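(* There exists an instance $(G,w,c)$ of the network bargaining game and a vector $x\in\mathcal{C}\cap\mathcal{K}$, where $\mathcal{C}$ and $\mathcal{K}$ are the core and the prekernel of the matching game associated with $(G,w,c)$, such that there exists no balanced solution $(M,z)$ to $(G,w,c)$ satisfying $x_u=\sum_{v:\,uv\in M}z_{uv}$ for all $u\in V(G)$.
   Context: An instance of the network bargaining game is a triple $(G,w,c)$ where $G$ is a finite undirected graph (no loops or parallel edges), $w\in\mathbb{R}_+^{|E(G)|}$ is a vector of nonnegative edge weights and $c\in\mathbb{Z}_+^{|V(G)|}$ is a vector of vertex capacities. A set $M\subseteq E(G)$ is a $c$-matching of $G$ if $|\{v: uv\in M\}|\le c_u$ for all $u\in V(G)$. Given a $c$-matching $M$, $d_u$ denotes the degree of $u$ in $M$, and $u$ is saturated in $M$ if $d_u=c_u$. A solution is a pair $(M,z)$ where $M$ is a $c$-matching of $G$ and $z\in\mathbb{R}_+^{2|E(G)|}$ assigns each edge $uv$ a pair of nonnegative values $z_{uv},z_{vu}$ such that $z_{uv}+z_{vu}=w_{uv}$ if $uv\in M$ and $z_{uv}=z_{vu}=0$ otherwise. The outside option of vertex $u$ with respect to $(M,z)$ is $$\alpha_u(M,z)=\max\Big(0,\ \max_{v:\,uv\in E(G)\setminus M}\big(w_{uv}-\mathbf{1}_{[d_v=c_v]}\min_{vw\in M}z_{vw}\big)\Big),$$ where $\mathbf{1}_{[\cdot]}$ is the indicator of an event; $\alpha_u(M,z)=0$ if $\{v: uv\in E(G)\setminus M\}=\emptyset$. (The inner minimum is used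 only when $v$ is saturated; if $c_v=0$ it is a minimum over the empty set and is read as $+\infty$.) A solution $(M,z)$ is stable if $z_{uv}\ge\alpha_u(M,z)$ for every $uv\in M$ (for both endpoints of the edge), and $\alpha_u(M,z)=0$ for every unsaturated vertex $u$. It is balanced if it is stable and in addition $z_{uv}-\alpha_u(M,z)=z_{vu}-\alpha_v(M,z)$ for all $uv\in M$. The matching game associated with $(G,w,c)$ has player set $N=V(G)$ and value function $\nu(S)=\max\{w(M): M \text{ a } c\text{-matching of } G[S]\}$ for $S\subseteq N$, where $w(M)=\sum_{uv\in M}w_{uv}$ and $G[S]$ is the induced subgraph. For $x\in\mathbb{R}_+^{|N|}$ write $x(S)=\sum_{u\in S}x_u$, and for distinct $u,v\in N$ let $s_{uv}(x)=\max_{S\subseteq N:\,u\in S,\,v\notin S}\big(\nu(S)-x(S)\big)$. The core is $\mathcal{C}=\{x\in\mathbb{R}_+^{|N|}: x(S)\ge\nu(S)\ \forall S\subset N,\ x(N)=\nu(N)\}$ and the prekernel is $\mathcal{K}=\{x\in\mathbb{R}_+^{|N|}: s_{uv}(x)=s_{vu}(x)\ \forall\, u,v\in N,\ u\neq v\}$. *)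

theory Defs
  imports "HOL-Library.Extended_Real"
begin

text \<open>
  A network bargaining instance is given by a finite vertex set \<open>V\<close>, a set \<open>E\<close> of two-element
  subsets of \<open>V\<close>, edge weights \<open>w\<close> and vertex capacities \<open>c\<close>. All functions are total; only their
  values on vertices and edges of the graph matter.
\<close>

definition simple_graph :: "'a set \<Rightarrow> 'a set set \<Rightarrow> bool" where
  "simple_graph V E \<longleftrightarrow> finite V \<and> (\<forall>e\<in>E. e \<subseteq> V \<and> card e = 2)"

definition bargaining_instance ::
  "'a set \<Rightarrow> 'a set set \<Rightarrow> ('a set \<Rightarrow> real) \<Rightarrow> ('a \<Rightarrow> nat) \<Rightarrow> bool" where
  "bargaining_instance V E w c \<longleftrightarrow> simple_graph V E \<and> (\<forall>e\<in>E. 0 \<le> w e)"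

definition nbrs :: "'a set set \<Rightarrow> 'a \<Rightarrow> 'a set" where
  "nbrs F u = {v. {u, v} \<in> F}"

definition c_matching :: "'a set \<Rightarrow> 'a set set \<Rightarrow> ('a \<Rightarrow> nat) \<Rightarrow> 'a set set \<Rightarrow> bool" where
  "c_matching V E c M \<longleftrightarrow> M \<subseteq> E \<and> (\<forall>u\<in>V. card (nbrs M u) \<le> c u)"

definition saturated :: "('a \<Rightarrow> nat) \<Rightarrow> 'a set set \<Rightarrow> 'a \<Rightarrow> bool" where
  "saturated c M u \<longleftrightarrow> card (nbrs M u) = c u"

text \<open>The value \<open>z u v\<close> is the share of \<open>u\<close> in the edge \<open>{u, v}\<close>.\<close>

definition solution ::
  "'a set \<Rightarrow> 'a set set \<Rightarrow> ('a set \<Rightarrow> real) \<Rightarrow> ('a \<Rightarrow> nat) \<Rightarrow>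
    'a set set \<Rightarrow> ('a \<Rightarrow> 'a \<Rightarrow> real) \<Rightarrow> bool" where
  "solution V E w c M z \<longleftrightarrow>
     c_matching V E c M \<and>
     (\<forall>u v. {u, v} \<in> E \<longrightarrow>
        0 \<le> z u v \<and> 0 \<le> z v u \<and>
        ({u, v} \<in> M \<longrightarrow> z u v + z v u = w {u, v}) \<and>
        ({u, v} \<notin> M \<longrightarrow> z u v = 0 \<and> z v u = 0))"

text \<open>
  Extrema over finite index sets are taken in \<open>ereal\<close>, so that the minimum over the empty set,
  which occurs for a neighbour of capacity 0, is \<open>\<infinity>\<close>, and the maximum over the empty set is
  \<open>-\<infinity>\<close> and is then absorbed by \<open>max 0\<close>. On an instance the outside option itself is always finite.
\<close>

definition outside_option ::
  "'a set set \<Rightarrow> ('a set \<Rightarrow> real) \<Rightarrow> ('a \<Rightarrow> nat) \<Rightarrow>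
    'a set set \<Rightarrow> ('a \<Rightarrow> 'a \<Rightarrow> real) \<Rightarrow> 'a \<Rightarrow> ereal" where
  "outside_option E w c M z u =
     max 0 (SUP v \<in> nbrs (E - M) u.
       ereal (w {u, v}) -
         (if saturated c M v then (INF t \<in> nbrs M v. ereal (z v t)) else 0))"

definition stable_solution ::
  "'a set \<Rightarrow> 'a set set \<Rightarrow> ('a set \<Rightarrow> real) \<Rightarrow> ('a \<Rightarrow> nat) \<Rightarrow>
    'a set set \<Rightarrow> ('a \<Rightarrow> 'a \<Rightarrow> real) \<Rightarrow> bool" where
  "stable_solution V E w c M z \<longleftrightarrow>
     solution V E w c M z \<and>
     (\<forall>u v. {u, v} \<in> M \<longrightarrow> outside_option E w c M z u \<le> ereal (z u v)) \<and>
     (\<forall>u\<in>V. \<not> saturated c M u \<longrightarrow> outside_option E w c M z u = 0)"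

definition balanced_solution ::
  "'a set \<Rightarrow> 'a set set \<Rightarrow> ('a set \<Rightarrow> real) \<Rightarrow> ('a \<Rightarrow> nat) \<Rightarrow>
    'a set set \<Rightarrow> ('a \<Rightarrow> 'a \<Rightarrow> real) \<Rightarrow> bool" where
  "balanced_solution V E w c M z \<longleftrightarrow>
     stable_solution V E w c M z \<and>
     (\<forall>u v. {u, v} \<in> M \<longrightarrow>
        ereal (z u v) - outside_option E w c M z u =
        ereal (z v u) - outside_option E w c M z v)"

definition induced_edges :: "'a set set \<Rightarrow> 'a set \<Rightarrow> 'a set set" where
  "induced_edges E S = {e \<in> E. e \<subseteq> S}"

definition game_value ::
  "'a set set \<Rightarrow> ('a set \<Rightarrow> real) \<Rightarrow> ('a \<Rightarrow> nat) \<Rightarrow> 'a set \<Rightarrow> real" where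
  "game_value E w c S = Max {sum w M | M. c_matching S (induced_edges E S) c M}"

definition surplus ::
  "'a set \<Rightarrow> 'a set set \<Rightarrow> ('a set \<Rightarrow> real) \<Rightarrow> ('a \<Rightarrow> nat) \<Rightarrow>
    ('a \<Rightarrow> real) \<Rightarrow> 'a \<Rightarrow> 'a \<Rightarrow> real" where
  "surplus V E w c x u v =
     Max {game_value E w c S - sum x S | S. S \<subseteq> V \<and> u \<in> S \<and> v \<notin> S}"

definition core ::
  "'a set \<Rightarrow> 'a set set \<Rightarrow> ('a set \<Rightarrow> real) \<Rightarrow> ('a \<Rightarrow> nat) \<Rightarrow> ('a \<Rightarrow> real) set" where
  "core V E w c =
     {x. (\<forall>u\<in>V. 0 \<le> x u) \<and>
         (\<forall>S. S \<subset> V \<longrightarrow> game_value E w c S \<le> sum x S) \<and>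
         sum x V = game_value E w c V}"

definition prekernel ::
  "'a set \<Rightarrow> 'a set set \<Rightarrow> ('a set \<Rightarrow> real) \<Rightarrow> ('a \<Rightarrow> nat) \<Rightarrow> ('a \<Rightarrow> real) set" where
  "prekernel V E w c =
     {x. (\<forall>u\<in>V. 0 \<le> x u) \<and>
         (\<forall>u\<in>V. \<forall>v\<in>V. u \<noteq> v \<longrightarrow> surplus V E w c x u v = surplus V E w c x v u)}"

end

(*
  The instance is the complete graph K4 with unit weights and capacities 2, 2, 2, 3, and x is
  constantly 1. Since the capacities add up to the odd number 9, a c-matching has at most 4 edges,
  and some vertex u is unsaturated. Every triangle is a tight coalition of the core vector x, so all
  surpluses vanish and x lies in the prekernel. In a stable solution u has outside option 0, although
  it has a neighbour v outside the matching; so v is saturated and receives at least 1 from each of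
  its c v \<ge> 2 matching edges, contradicting x v = 1.
*)
theory Submission
  imports Defs
begin

section \<open>Finite simple graphs and degree counting\<close>

lemma simple_graph_finite_edges: "simple_graph V E \<Longrightarrow> finite E"
  unfolding simple_graph_def by (meson PowI finite_Pow_iff finite_subset subsetI)

lemma simple_graph_subset: "simple_graph V E \<Longrightarrow> M \<subseteq> E \<Longrightarrow> simple_graph V M"
  unfolding simple_graph_def by blast

lemma simple_graph_induced:
  "simple_graph V E \<Longrightarrow> S \<subseteq> V \<Longrightarrow> simple_graph S (induced_edges E S)"
  unfolding simple_graph_def induced_edges_def using finite_subset by blast

lemma simple_graph_nbrs:
  assumes "simple_graph V E"
  shows "nbrs E u \<subseteq> V - {u}"
proof
  fix v assume "v \<in> nbrs E u"
  then have "{u, v} \<in> E" by (simp add: nbrs_def)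
  then have "{u, v} \<subseteq> V" "card {u, v} = 2"
    using assms by (auto simp: simple_graph_def)
  then show "v \<in> V - {u}" by auto
qed

text \<open>Double counting of incidences: \<open>v\<close> \<mapsto> \<open>{u, v}\<close> is a
  bijection from the neighbours of \<open>u\<close> onto the edges at \<open>u\<close>, and every
  edge is counted at exactly two vertices.\<close>

lemma handshake:
  assumes "simple_graph V E"
  shows "(\<Sum>u\<in>V. card (nbrs E u)) = 2 * card E"
proof -
  have fin: "finite V" "finite E"
    using assms simple_graph_finite_edges by (auto simp: simple_graph_def)
  have "card (nbrs E u) = card {e \<in> E. u \<in> e}" for u
  proof (rule bij_betw_same_card)
    show "bij_betw (\<lambda>v. {u, v}) (nbrs E u) {e \<in> E. u \<in> e}"
    proof (rule bij_betw_imageI)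
      show "inj_on (\<lambda>v. {u, v}) (nbrs E u)"
        by (auto simp: inj_on_def doubleton_eq_iff)
      show "(\<lambda>v. {u, v}) ` nbrs E u = {e \<in> E. u \<in> e}"
      proof (intro equalityI subsetI)
        fix e assume e: "e \<in> {e \<in> E. u \<in> e}"
        then have "card e = 2" using assms by (auto simp: simple_graph_def)
        then obtain v where "e = {u, v}" using e by (auto simp: card_2_iff)
        then show "e \<in> (\<lambda>v. {u, v}) ` nbrs E u" using e by (auto simp: nbrs_def)
      qed (auto simp: nbrs_def)
    qed
  qed
  then have "(\<Sum>u\<in>V. card (nbrs E u)) = (\<Sum>u\<in>V. card {e \<in> E. u \<in> e})" by simp
  also have "\<dots> = 2 * card E"
  proof (rule sum_multicount)
    show "\<forall>e\<in>E. card {u \<in> V. u \<in> e} = 2"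
    proof
      fix e assume "e \<in> E"
      then have "{u \<in> V. u \<in> e} = e" "card e = 2"
        using assms by (auto simp: simple_graph_def)
      then show "card {u \<in> V. u \<in> e} = 2" by simp
    qed
  qed (use fin in auto)
  finally show ?thesis .
qed

lemma c_matching_card_le:
  assumes "simple_graph V E" "c_matching V E c M"
  shows "2 * card M \<le> (\<Sum>u\<in>V. c u)"
  using handshake[OF simple_graph_subset[OF assms(1)], of M] assms(2)
    sum_mono[of V "\<lambda>u. card (nbrs M u)" c]
  by (auto simp: c_matching_def)

section \<open>Values and surpluses of the matching game\<close>

lemma finite_matching_weights:
  assumes "finite E"
  shows "finite {sum w M | M. c_matching S (induced_edges E S) c M}"
proof (rule finite_subset)
  show "{sum w M | M. c_matching S (induced_edges E S) c M} \<subseteq> sum w ` Pow E"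
    by (auto simp: c_matching_def induced_edges_def)
qed (use assms in simp)

lemma game_value_ge:
  assumes "finite E" "c_matching S (induced_edges E S) c M"
  shows "sum w M \<le> game_value E w c S"
  unfolding game_value_def using assms by (intro Max_ge finite_matching_weights) auto

lemma game_value_le:
  assumes "finite E" "\<And>M. c_matching S (induced_edges E S) c M \<Longrightarrow> sum w M \<le> b"
  shows "game_value E w c S \<le> b"
proof -
  \<comment> \<open>The empty matching makes the set of weights nonempty, so that its
    \<open>Max\<close> is meaningful.\<close>
  have "c_matching S (induced_edges E S) c {}" by (simp add: c_matching_def nbrs_def)
  then show ?thesis
    unfolding game_value_def using assms by (subst Max_le_iff) (auto intro: finite_matching_weights)
qed

text \<open>A core vector leaves no coalition a positive excess, and the tight coalition
  \<open>S\<close> attains the bound 0.\<close>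

lemma surplus_eq_0_of_tight:
  assumes "finite V" "x \<in> core V E w c"
    and "S \<subseteq> V" "u \<in> S" "v \<in> V - S" "game_value E w c S = sum x S"
  shows "surplus V E w c x u v = 0"
  unfolding surplus_def
proof (rule Max_eqI)
  have "{game_value E w c S - sum x S | S. S \<subseteq> V \<and> u \<in> S \<and> v \<notin> S}
      \<subseteq> (\<lambda>S. game_value E w c S - sum x S) ` Pow V" by auto
  then show "finite {game_value E w c S - sum x S | S. S \<subseteq> V \<and> u \<in> S \<and> v \<notin> S}"
    using \<open>finite V\<close> by (meson finite_Pow_iff finite_imageI finite_subset)
next
  fix y assume "y \<in> {game_value E w c S - sum x S | S. S \<subseteq> V \<and> u \<in> S \<and> v \<notin> S}"
  \<comment> \<open>The inclusion is proper because \<open>v\<close> lies in \<open>V\<close> but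
    not in the coalition, so the core inequality applies.\<close>
  then obtain T where "T \<subset> V" "y = game_value E w c T - sum x T"
    using assms(5) by blast
  then show "y \<le> 0" using assms(2) by (auto simp: core_def)
next
  show "0 \<in> {game_value E w c S - sum x S | S. S \<subseteq> V \<and> u \<in> S \<and> v \<notin> S}"
    using assms(3-6) by force
qed

section \<open>Stability at an unsaturated vertex\<close>

text \<open>Since \<open>u\<close> has outside option 0, the term contributed by \<open>v\<close> is
  at most 0. For unsaturated \<open>v\<close> that term would be the positive weight itself; for
  saturated \<open>v\<close> it bounds the least share of \<open>v\<close> from below.\<close>

lemma stable_unsaturated_nbr:
  assumes st: "stable_solution V E w c M z"
    and u: "u \<in> V" "\<not> saturated c M u" and uv: "{u, v} \<in> E - M" and pos: "0 < w {u, v}"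
  shows "saturated c M v" and "\<And>t. t \<in> nbrs M v \<Longrightarrow> w {u, v} \<le> z v t"
proof -
  let ?f = "\<lambda>v. ereal (w {u, v}) -
    (if saturated c M v then (INF t \<in> nbrs M v. ereal (z v t)) else 0)"
  have "outside_option E w c M z u = 0"
    using st u by (simp add: stable_solution_def)
  moreover have "?f v \<le> (SUP v \<in> nbrs (E - M) u. ?f v)"
    using uv by (intro SUP_upper) (simp add: nbrs_def)
  ultimately have le: "?f v \<le> 0"
    unfolding outside_option_def by (metis (lifting) max.cobounded2 order_trans)
  show sat: "saturated c M v"
    using le pos by (auto split: if_splits)
  fix t assume "t \<in> nbrs M v"
  then have "(INF t \<in> nbrs M v. ereal (z v t)) \<le> ereal (z v t)"
    by (rule INF_lower)
  \<comment> \<open>The case split deals with infinite infima: \<infinity> satisfies the bound, and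
    -\<infinity> contradicts \<open>le\<close>.\<close>
  moreover have "ereal (w {u, v}) \<le> (INF t \<in> nbrs M v. ereal (z v t))"
    using le sat by (cases "INF t \<in> nbrs M v. ereal (z v t)") auto
  ultimately show "w {u, v} \<le> z v t"
    by (metis ereal_less_eq(3) order_trans)
qed

text \<open>By saturation \<open>v\<close> has exactly \<open>c v\<close> matching edges, and each
  of them pays \<open>v\<close> at least \<open>w {u, v}\<close>.\<close>

lemma stable_unsaturated_nbr_payoff:
  assumes "stable_solution V E w c M z" "u \<in> V" "\<not> saturated c M u"
    "{u, v} \<in> E - M" "0 < w {u, v}"
  shows "real (c v) * w {u, v} \<le> (\<Sum>t\<in>nbrs M v. z v t)"
proof -
  have "real (card (nbrs M v)) * w {u, v} \<le> (\<Sum>t\<in>nbrs M v. z v t)"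
    using stable_unsaturated_nbr(2)[OF assms] by (intro sum_bounded_below) auto
  then show ?thesis
    using stable_unsaturated_nbr(1)[OF assms] by (simp add: saturated_def)
qed

section \<open>The instance on the complete graph with four vertices\<close>

definition complete_edges :: "'a set \<Rightarrow> 'a set set" where
  "complete_edges V = {e. e \<subseteq> V \<and> card e = 2}"

lemma simple_graph_complete: "finite V \<Longrightarrow> simple_graph V (complete_edges V)"
  by (simp add: simple_graph_def complete_edges_def)

text \<open>With all capacities 2 a 4-cycle would saturate every vertex; one capacity 3 makes the
  total odd. Capacities of at least 2 still admit every triangle as a matching.\<close>

definition K4_cap :: "nat \<Rightarrow> nat" where
  "K4_cap u = (if u = 3 then 3 else 2)"

abbreviation K4_val :: "nat set \<Rightarrow> real" where
  "K4_val \<equiv> game_value (complete_edges {..<4}) (\<lambda>_. 1) K4_cap"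

lemma finite_K4: "finite (complete_edges {..<4::nat})"
  using simple_graph_finite_edges simple_graph_complete by blast

lemma sum_K4_cap: "(\<Sum>u<4. K4_cap u) = 9"
  by (simp add: K4_cap_def eval_nat_numeral)

text \<open>These are the core inequalities for the constant vector 1. On all four vertices the
  capacities give the bound; on fewer vertices every degree is at most 2, so there are at most as
  many edges as vertices.\<close>

lemma K4_val_le_card:
  assumes S: "S \<subseteq> {..<4}"
  shows "K4_val S \<le> real (card S)"
proof (rule game_value_le[OF finite_K4])
  fix M assume M: "c_matching S (induced_edges (complete_edges {..<4}) S) K4_cap M"
  have fin: "finite S" using S finite_subset by blast
  have gr: "simple_graph S (induced_edges (complete_edges {..<4}) S)"
    using simple_graph_induced[OF simple_graph_complete S] by simp
  have "card M \<le> card S"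
  proof (cases "S = {..<4}")
    case True
    \<comment> \<open>Integrality matters: \<open>2 * card M\<close> is at most 9, hence
      \<open>card M\<close> is at most 4.\<close>
    then show ?thesis using c_matching_card_le[OF gr M] sum_K4_cap by simp
  next
    case False
    then have "card S < 4"
      using S psubset_card_mono[of "{..<4}" S] by auto
    have gM: "simple_graph S M"
      using simple_graph_subset[OF gr] M by (simp add: c_matching_def)
    have "card (nbrs M u) \<le> 2" if "u \<in> S" for u
    proof -
      have "card (nbrs M u) \<le> card (S - {u})"
        using simple_graph_nbrs[OF gM] fin by (intro card_mono) auto
      then show ?thesis using that fin \<open>card S < 4\<close> by simp
    qed
    then have "(\<Sum>u\<in>S. card (nbrs M u)) \<le> card S * 2"
      using sum_bounded_above[of S "\<lambda>u. card (nbrs M u)" 2] by simp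
    then show ?thesis using handshake[OF gM] by simp
  qed
  then show "(\<Sum>e\<in>M. 1::real) \<le> real (card S)" by simp
qed

text \<open>Within three vertices no degree exceeds 2, so all three edges together respect the
  capacities.\<close>

lemma K4_val_triangle:
  assumes S: "S \<subseteq> {..<4}" and "card S = 3"
  shows "K4_val S = 3"
proof (rule antisym)
  have fin: "finite S" using S finite_subset by blast
  have "card (nbrs (complete_edges S) u) \<le> K4_cap u" if "u \<in> S" for u
  proof -
    have "card (nbrs (complete_edges S) u) \<le> card (S - {u})"
      using simple_graph_nbrs[OF simple_graph_complete[OF fin]] fin by (intro card_mono) auto
    then show ?thesis using that fin \<open>card S = 3\<close> by (auto simp: K4_cap_def)
  qed
  then have "c_matching S (induced_edges (complete_edges {..<4}) S) K4_cap (complete_edges S)"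
    using S by (auto simp: c_matching_def induced_edges_def complete_edges_def)
  from game_value_ge[OF finite_K4 this, of "\<lambda>_. 1"]
  have "real (card (complete_edges S)) \<le> K4_val S" by simp
  moreover have "card (complete_edges S) = 3"
    using n_subsets[OF fin, of 2] \<open>card S = 3\<close>
    by (simp add: complete_edges_def numeral_3_eq_3 numeral_2_eq_2)
  ultimately show "3 \<le> K4_val S" by simp
qed (use K4_val_le_card[OF S] assms(2) in simp)

lemma K4_val_all: "K4_val {..<4} = 4"
proof (rule antisym)
  \<comment> \<open>A Hamiltonian 4-cycle: every degree is 2, and its four edges meet the upper
    bound.\<close>
  let ?M = "{{0, 1}, {1, 2}, {2, 3}, {0, 3}} :: nat set set"
  have nb: "nbrs ?M 0 = {1, 3}" "nbrs ?M 1 = {0, 2}" "nbrs ?M 2 = {1, 3}" "nbrs ?M 3 = {0, 2}"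
    by (auto simp: nbrs_def doubleton_eq_iff)
  have "\<forall>u\<in>{0, 1, 2, 3}. card (nbrs ?M u) \<le> K4_cap u"
    unfolding ball_simps nb by (simp add: K4_cap_def)
  moreover have "{..<4} = {0, 1, 2, 3 :: nat}" by auto
  ultimately have
    "c_matching {..<4} (induced_edges (complete_edges {..<4}) {..<4}) K4_cap ?M"
    by (auto simp: c_matching_def induced_edges_def complete_edges_def)
  from game_value_ge[OF finite_K4 this, of "\<lambda>_. 1"]
  show "4 \<le> K4_val {..<4}" by (simp add: doubleton_eq_iff)
qed (use K4_val_le_card[of "{..<4}"] in simp)

lemma K4_core: "(\<lambda>_. 1) \<in> core {..<4} (complete_edges {..<4}) (\<lambda>_. 1) K4_cap"
  using K4_val_le_card K4_val_all by (auto simp: core_def)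

text \<open>The triangle omitting \<open>v\<close> contains \<open>u\<close> and is tight, its value
  and its payoff both being 3.\<close>

lemma K4_surplus:
  assumes "u < 4" "v < 4" "u \<noteq> v"
  shows "surplus {..<4} (complete_edges {..<4}) (\<lambda>_. 1) K4_cap (\<lambda>_. 1) u v = 0"
  using assms K4_val_triangle[of "{..<4} - {v}"]
  by (intro surplus_eq_0_of_tight[where S = "{..<4} - {v}"] K4_core) auto

lemma K4_no_stable_solution:
  assumes st: "stable_solution {..<4} (complete_edges {..<4}) (\<lambda>_. 1) K4_cap M z"
    and x: "\<forall>u<4. (\<Sum>v\<in>nbrs M u. z u v) = 1"
  shows False
proof -
  have M: "c_matching {..<4} (complete_edges {..<4}) K4_cap M"
    using st by (simp add: stable_solution_def solution_def)
  then have gM: "simple_graph {..<4} M"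
    using simple_graph_subset[OF simple_graph_complete] by (auto simp: c_matching_def)
  have "\<exists>u<4. \<not> saturated K4_cap M u"
  proof (rule ccontr)
    assume "\<not> ?thesis"
    \<comment> \<open>If all vertices were saturated, the degrees would sum to the total
      capacity.\<close>
    then have "2 * card M = 9"
      using handshake[OF gM] sum_K4_cap by (simp add: saturated_def)
    then have "even (9::nat)" by (metis dvd_triv_left)
    then show False by simp
  qed
  then obtain u where u: "u < 4" "\<not> saturated K4_cap M u" by blast
  \<comment> \<open>The degree of \<open>u\<close> is strictly below its capacity, which is at most
    3, so \<open>u\<close> cannot be matched to all three other vertices.\<close>
  have "card (nbrs M u) \<le> K4_cap u" "card (nbrs M u) \<noteq> K4_cap u"
    using M u by (simp_all add: c_matching_def saturated_def)
  then have "card (nbrs M u) < 3" by (simp add: K4_cap_def split: if_splits)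
  also have "3 = card ({..<4} - {u})" using u by simp
  finally have "nbrs M u \<noteq> {..<4} - {u}" by (metis less_irrefl)
  then obtain v where "v \<in> {..<4} - {u}" "v \<notin> nbrs M u"
    using simple_graph_nbrs[OF gM, of u] by blast
  then have v: "v < 4" "v \<noteq> u" "{u, v} \<notin> M" by (simp_all add: nbrs_def)
  then have "{u, v} \<in> complete_edges {..<4} - M"
    using u by (auto simp: complete_edges_def)
  then have "real (K4_cap v) \<le> (\<Sum>t\<in>nbrs M v. z v t)"
    using stable_unsaturated_nbr_payoff[OF st, of u v] u by simp
  \<comment> \<open>The payoff of \<open>v\<close> would be at least its capacity, hence at least 2,
    whereas it is 1.\<close>
  then show False using x v by (simp add: K4_cap_def split: if_splits)
qed

theorem mainTheorem3:
  shows "\<exists>(V :: nat set) E w c x.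
    bargaining_instance V E w c \<and>
    x \<in> core V E w c \<inter> prekernel V E w c \<and>
    \<not> (\<exists>M z. balanced_solution V E w c M z \<and>
          (\<forall>u\<in>V. x u = (\<Sum>v\<in>nbrs M u. z u v)))"
proof (intro exI conjI)
  show "bargaining_instance {..<4} (complete_edges {..<4}) (\<lambda>_. 1) K4_cap"
    by (simp add: bargaining_instance_def simple_graph_complete)
  show "(\<lambda>_. 1) \<in> core {..<4} (complete_edges {..<4}) (\<lambda>_. 1) K4_cap
      \<inter> prekernel {..<4} (complete_edges {..<4}) (\<lambda>_. 1) K4_cap"
    using K4_core K4_surplus by (simp add: prekernel_def)
  show "\<not> (\<exists>M z. balanced_solution {..<4} (complete_edges {..<4}) (\<lambda>_. 1) K4_cap M z \<and>
      (\<forall>u\<in>{..<4}. 1 = (\<Sum>v\<in>nbrs M u. z u v)))"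
  proof (intro notI, elim exE conjE)
    fix M z
    assume "balanced_solution {..<4} (complete_edges {..<4}) (\<lambda>_. 1) K4_cap M z"
      and x: "\<forall>u\<in>{..<4}. 1 = (\<Sum>v\<in>nbrs M u. z u v)"
    then have "stable_solution {..<4} (complete_edges {..<4}) (\<lambda>_. 1) K4_cap M z"
      by (simp add: balanced_solution_def)
    then show False by (rule K4_no_stable_solution) (use x in simp)
  qed
qed

end
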